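(* Let $n\in\mathbb{Z}$ and let $\theta_n$ be a root of $f_n(x)=x^3-nx^2+(n-1)x-1$. The ideal class monoid $C(\mathbb{Z}[\theta_n])$ is not a group if and only if there exist an integer $c$ and a prime number $p$ satisfying simultaneously (1) $(2c-1)\,n\equiv 3c^2-1 \pmod{p}$, and (2) $(c^2-c)\,n\equiv c^3-c-1 \pmod{p^2}$. Moreover, whenever an integer $c$ and a prime $p$ satisfy (1) and (2), the ideal $\langle \theta_n-c,\,p\rangle$ of $\mathbb{Z}[\theta_n]$ is not invertible.
   Context: $f_n$ is irreducible over $\mathbb{Q}$ for all $n$, so $\mathbb{Z}[\theta_n]$ is an order in the cubic number field $\mathbb{Q}(\theta_n)$. For an integral domain $R$, two nonzero ideals $I,J$ are equivalent if $\alpha I=\beta J$ for some nonzero $\alpha,\beta\in R$; the set of equivalence classes of nonzero ideals with the multiplication induced by ideal multiplication is a monoid with identity $[R]$, called the ideal class monoid $C(R)$. A nonzero ideal $I$ is invertible if $[I]$ is an invertible element of $C(R)$. *)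

theory Defs
  imports Complex_Main "HOL-Computational_Algebra.Polynomial" "HOL-Number_Theory.Cong"
begin

definition fpoly :: "int \<Rightarrow> complex poly" where
  "fpoly n = [:-1, of_int (n - 1), - of_int n, 1:]"

definition Zadj :: "complex \<Rightarrow> complex set" where
  "Zadj \<theta> = {poly (map_poly of_int p) \<theta> | p :: int poly. True}"

definition is_cideal :: "complex set \<Rightarrow> complex set \<Rightarrow> bool" where
  "is_cideal R I \<longleftrightarrow> I \<subseteq> R \<and> 0 \<in> I \<and> (\<forall>x\<in>I. \<forall>y\<in>I. x + y \<in> I)
     \<and> (\<forall>r\<in>R. \<forall>x\<in>I. r * x \<in> I)"

definition nonzero_ideal :: "complex set \<Rightarrow> complex set \<Rightarrow> bool" where
  "nonzero_ideal R I \<longleftrightarrow> is_cideal R I \<and> I \<noteq> {0}"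

definition ideal_mult_set :: "complex set \<Rightarrow> complex set \<Rightarrow> complex set" where
  "ideal_mult_set I J = {(\<Sum>i<k. x i * y i) | (k::nat) x y. \<forall>i<k. x i \<in> I \<and> y i \<in> J}"

definition ideal_equiv :: "complex set \<Rightarrow> complex set \<Rightarrow> complex set \<Rightarrow> bool" where
  "ideal_equiv R I J \<longleftrightarrow> (\<exists>\<alpha>\<in>R. \<exists>\<beta>\<in>R. \<alpha> \<noteq> 0 \<and> \<beta> \<noteq> 0 \<and> (\<lambda>x. \<alpha> * x) ` I = (\<lambda>x. \<beta> * x) ` J)"

text \<open>A nonzero ideal is invertible iff its class is a unit of the (commutative)
  ideal class monoid C(R), i.e. [I][J] = [IJ] = [R] for some nonzero ideal J.\<close>
definition invertible_cideal :: "complex set \<Rightarrow> complex set \<Rightarrow> bool" where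
  "invertible_cideal R I \<longleftrightarrow> nonzero_ideal R I \<and>
     (\<exists>J. nonzero_ideal R J \<and> ideal_equiv R (ideal_mult_set I J) R)"

definition class_monoid_is_group :: "complex set \<Rightarrow> bool" where
  "class_monoid_is_group R \<longleftrightarrow> (\<forall>I. nonzero_ideal R I \<longrightarrow> invertible_cideal R I)"

definition ideal2 :: "complex set \<Rightarrow> complex \<Rightarrow> complex \<Rightarrow> complex set" where
  "ideal2 R a b = {r * a + s * b | r s. r \<in> R \<and> s \<in> R}"

end

theory Submission
  imports Defs
begin

text \<open>For a subring in which every nonzero ideal is contained in only finitely many ideals, it is
  enough to invert the maximal ideals: among the invertible ideals containing \<open>I\<close> take a minimal
  one \<open>J\<close>; if \<open>I \<noteq> J\<close> then \<open>I J\<inverse>\<close> is a proper ideal, hence inside a maximal \<open>M\<close>, and \<open>M J\<close> is a smaller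
  invertible ideal containing \<open>I\<close>. For \<open>\<int>[\<theta>]\<close> a maximal ideal containing the prime \<open>p\<close> is
  \<open>(p)\<close>, \<open>(p, \<theta> - c)\<close> or \<open>(p, g(\<theta>))\<close> with \<open>g\<close> a monic quadratic. Writing \<open>f = g q + p h\<close>, the product
  \<open>(p, g(\<theta>)) (p, q(\<theta>))\<close> is \<open>p (p, g(\<theta>), q(\<theta>), h(\<theta>))\<close>, so invertibility can fail only for \<open>g = x - c\<close>
  with \<open>p\<close> dividing both \<open>q(c) = f'(c)\<close> and \<open>h = f(c) / p\<close>, which are the two congruences. If they
  hold, \<open>(t\<^sup>2 + (3 c - n) t) / p\<close> with \<open>t = \<theta> - c\<close> multiplies \<open>(t, p)\<close> into itself
  without lying in \<open>\<int>[\<theta>]\<close>.\<close>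

section \<open>Invertible ideals\<close>

lemma mult_mem_ideal_mult_set:
  assumes "x \<in> I" "y \<in> J"
  shows "x * y \<in> ideal_mult_set I J"
proof -
  have "x * y = (\<Sum>i<1::nat. x * y)" by simp
  then show ?thesis
    unfolding ideal_mult_set_def mem_Collect_eq using assms
    by (intro exI[of _ "1::nat"] exI[of _ "\<lambda>_. x"] exI[of _ "\<lambda>_. y"]) auto
qed

lemma zero_mem_ideal_mult_set: "0 \<in> ideal_mult_set I J"
  unfolding ideal_mult_set_def by (auto intro!: exI[of _ "0::nat"])

lemma add_mem_ideal_mult_set:
  assumes "u \<in> ideal_mult_set I J" "v \<in> ideal_mult_set I J"
  shows "u + v \<in> ideal_mult_set I J"
proof -
  obtain k :: nat and x y where u: "u = (\<Sum>i<k. x i * y i)" "\<forall>i<k. x i \<in> I \<and> y i \<in> J"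
    using assms(1) unfolding ideal_mult_set_def by blast
  obtain l :: nat and x' y' where v: "v = (\<Sum>i<l. x' i * y' i)" "\<forall>i<l. x' i \<in> I \<and> y' i \<in> J"
    using assms(2) unfolding ideal_mult_set_def by blast
  define X where "X i = (if i < k then x i else x' (i - k))" for i
  define Y where "Y i = (if i < k then y i else y' (i - k))" for i
  have "(\<Sum>i<k+l. X i * Y i) = (\<Sum>i<k. X i * Y i) + (\<Sum>i=k..<k+l. X i * Y i)"
    by (metis atLeast0LessThan le_add1 sum.atLeastLessThan_concat zero_le)
  also have "(\<Sum>i=k..<k+l. X i * Y i) = (\<Sum>i<l. x' i * y' i)"
    using sum.shift_bounds_nat_ivl[of "\<lambda>i. X i * Y i" 0 k l]
    by (simp add: X_def Y_def atLeast0LessThan add.commute)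
  also have "(\<Sum>i<k. X i * Y i) = (\<Sum>i<k. x i * y i)"
    by (simp add: X_def Y_def)
  finally have "u + v = (\<Sum>i<k+l. X i * Y i)" using u v by simp
  moreover have "\<forall>i<k+l. X i \<in> I \<and> Y i \<in> J"
    using u(2) v(2) by (auto simp: X_def Y_def)
  ultimately show ?thesis unfolding ideal_mult_set_def by blast
qed

text \<open>Hides the finite sums: later claims about \<open>I J\<close> are checked on single
  products and then only need to be additive.\<close>

lemma ideal_mult_set_induct [consumes 1, case_names zero mult add]:
  assumes "z \<in> ideal_mult_set I J"
    and "P 0"
    and "\<And>x y. x \<in> I \<Longrightarrow> y \<in> J \<Longrightarrow> P (x * y)"
    and "\<And>u v. P u \<Longrightarrow> P v \<Longrightarrow> P (u + v)"
  shows "P z"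
proof -
  obtain k :: nat and x y where z: "z = (\<Sum>i<k. x i * y i)" and xy: "\<forall>i<k. x i \<in> I \<and> y i \<in> J"
    using assms(1) unfolding ideal_mult_set_def by blast
  have "P (\<Sum>i<k. x i * y i)"
    using xy by (induction k) (auto intro: assms)
  then show ?thesis using z by simp
qed

lemma is_cidealD:
  assumes "is_cideal R I"
  shows "I \<subseteq> R" "0 \<in> I" "x \<in> I \<Longrightarrow> y \<in> I \<Longrightarrow> x + y \<in> I" "r \<in> R \<Longrightarrow> x \<in> I \<Longrightarrow> r * x \<in> I"
  using assms unfolding is_cideal_def by auto

lemma ideal2E:
  assumes "x \<in> ideal2 R a b"
  obtains r s where "r \<in> R" "s \<in> R" "x = r * a + s * b"
  using assms unfolding ideal2_def by blast

lemma ideal2I: "r \<in> R \<Longrightarrow> s \<in> R \<Longrightarrow> x = r * a + s * b \<Longrightarrow> x \<in> ideal2 R a b"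
  unfolding ideal2_def by blast

text \<open>Excluding the zero ideal makes every such \<open>M\<close> a candidate for
  invertibility.\<close>

definition maximal_cideal :: "complex set \<Rightarrow> complex set \<Rightarrow> bool" where
  "maximal_cideal R M \<longleftrightarrow> nonzero_ideal R M \<and> M \<noteq> R \<and>
     (\<forall>J. is_cideal R J \<longrightarrow> M \<subseteq> J \<longrightarrow> J = M \<or> J = R)"

section \<open>Subrings of the complex numbers and their ideals\<close>

locale complex_subring =
  fixes R :: "complex set"
  assumes one_mem [simp, intro]: "1 \<in> R"
    and uminus_mem [intro]: "x \<in> R \<Longrightarrow> - x \<in> R"
    and add_mem [intro]: "x \<in> R \<Longrightarrow> y \<in> R \<Longrightarrow> x + y \<in> R"
    and mult_mem [intro]: "x \<in> R \<Longrightarrow> y \<in> R \<Longrightarrow> x * y \<in> R"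
begin

lemma zero_mem [simp, intro]: "0 \<in> R"
  using add_mem[OF one_mem uminus_mem[OF one_mem]] by simp

lemma diff_mem [intro]: "x \<in> R \<Longrightarrow> y \<in> R \<Longrightarrow> x - y \<in> R"
  using add_mem[of x "- y"] by auto

lemma of_int_mem [simp, intro]: "of_int k \<in> R"
proof -
  have nat: "of_nat m \<in> R" for m
    by (induction m) auto
  show ?thesis
  proof (cases k)
    case (nonneg m)
    then show ?thesis using nat by simp
  next
    case (neg m)
    then show ?thesis using uminus_mem[OF nat[of "Suc m"]] by simp
  qed
qed

lemma ideal_diff:
  assumes "is_cideal R I" "x \<in> I" "y \<in> I"
  shows "x - y \<in> I"
  using is_cidealD(3)[OF assms(1,2), of "(-1) * y"] is_cidealD(4)[OF assms(1), of "-1" y] assms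
  by auto

lemma ideal_eq_ring:
  assumes "is_cideal R I" "1 \<in> I"
  shows "I = R"
  using is_cidealD(1)[OF assms(1)] is_cidealD(4)[OF assms(1) _ assms(2)] by auto

lemma is_cideal_ring: "is_cideal R R"
  unfolding is_cideal_def by auto

lemma is_cideal_mult:
  assumes "is_cideal R I" "is_cideal R J"
  shows "is_cideal R (ideal_mult_set I J)"
proof -
  have "x \<in> R" if "x \<in> ideal_mult_set I J" for x
    using that
    by (induction rule: ideal_mult_set_induct) (use is_cidealD(1)[OF assms(1)] is_cidealD(1)[OF assms(2)] in auto)
  moreover have "r * x \<in> ideal_mult_set I J" if "r \<in> R" "x \<in> ideal_mult_set I J" for r x
    using that(2)
  proof (induction rule: ideal_mult_set_induct)
    case (mult x y)
    then show ?case
      using mult_mem_ideal_mult_set[OF is_cidealD(4)[OF assms(1) that(1) mult(1)] mult(2)]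
      by (simp add: mult.assoc)
  qed (simp_all add: zero_mem_ideal_mult_set add_mem_ideal_mult_set distrib_left)
  ultimately show ?thesis
    unfolding is_cideal_def by (auto simp: zero_mem_ideal_mult_set intro: add_mem_ideal_mult_set)
qed

lemma is_cideal_ideal2:
  assumes a: "a \<in> R" and b: "b \<in> R"
  shows "is_cideal R (ideal2 R a b)"
  unfolding is_cideal_def
proof (intro conjI ballI)
  show "ideal2 R a b \<subseteq> R"
    by (auto elim!: ideal2E intro!: add_mem mult_mem a b)
  show "0 \<in> ideal2 R a b" by (rule ideal2I[OF zero_mem zero_mem]) simp
next
  fix x y assume x: "x \<in> ideal2 R a b" and y: "y \<in> ideal2 R a b"
  obtain r s where rs: "r \<in> R" "s \<in> R" "x = r * a + s * b"
    using x by (rule ideal2E)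
  obtain r' s' where rs': "r' \<in> R" "s' \<in> R" "y = r' * a + s' * b"
    using y by (rule ideal2E)
  show "x + y \<in> ideal2 R a b"
    by (rule ideal2I[OF add_mem[OF rs(1) rs'(1)] add_mem[OF rs(2) rs'(2)]])
      (unfold rs(3) rs'(3), simp add: algebra_simps)
next
  fix l x assume l: "l \<in> R" and x: "x \<in> ideal2 R a b"
  obtain r s where rs: "r \<in> R" "s \<in> R" "x = r * a + s * b"
    using x by (rule ideal2E)
  show "l * x \<in> ideal2 R a b"
    by (rule ideal2I[OF mult_mem[OF l rs(1)] mult_mem[OF l rs(2)]])
      (unfold rs(3), simp add: algebra_simps)
qed

lemma principal_add:
  assumes "u \<in> (*) d ` R" "v \<in> (*) d ` R"
  shows "u + v \<in> (*) d ` R"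
  using assms by (auto simp flip: distrib_left)

lemma principal_zero: "0 \<in> (*) d ` R"
  by (auto intro: image_eqI[of _ _ 0])

lemma nonzero_ideal_mult:
  assumes "nonzero_ideal R I" "nonzero_ideal R J"
  shows "nonzero_ideal R (ideal_mult_set I J)"
proof -
  obtain x y where "x \<in> I" "x \<noteq> 0" "y \<in> J" "y \<noteq> 0"
    using assms is_cidealD(2) unfolding nonzero_ideal_def by blast
  then have "x * y \<in> ideal_mult_set I J" "x * y \<noteq> 0"
    using mult_mem_ideal_mult_set by auto
  then show ?thesis
    using assms is_cideal_mult unfolding nonzero_ideal_def by blast
qed

section \<open>Invertibility as having a principal product\<close>

text \<open>The two hypotheses on \<open>d\<close> and on single products are the two inclusions of
  \<open>I J = d R\<close>, which is the class relation with multipliers \<open>1\<close> and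
  \<open>d\<close>.\<close>

lemma invertible_cidealI:
  assumes "nonzero_ideal R I" "nonzero_ideal R J" "d \<noteq> 0" "d \<in> ideal_mult_set I J"
    and "\<And>x y. x \<in> I \<Longrightarrow> y \<in> J \<Longrightarrow> x * y \<in> (*) d ` R"
  shows "invertible_cideal R I"
proof -
  have id: "is_cideal R (ideal_mult_set I J)"
    using assms is_cideal_mult unfolding nonzero_ideal_def by blast
  have "x \<in> (*) d ` R" if "x \<in> ideal_mult_set I J" for x
    using that
  proof (induction rule: ideal_mult_set_induct)
    case (mult x y)
    then show ?case by (rule assms(5))
  qed (simp_all only: principal_zero principal_add)
  moreover have "d * r \<in> ideal_mult_set I J" if "r \<in> R" for r
    using is_cidealD(4)[OF id that assms(4)] by (simp add: mult.commute)
  ultimately have "ideal_mult_set I J = (*) d ` R" by blast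
  moreover have "d \<in> R" using is_cidealD(1)[OF id] assms(4) by blast
  ultimately have "ideal_equiv R (ideal_mult_set I J) R"
    unfolding ideal_equiv_def using assms(3)
    by (intro bexI[of _ 1] bexI[of _ d]) auto
  then show ?thesis using assms(1,2) unfolding invertible_cideal_def by blast
qed

text \<open>Division in the complex field turns \<open>\<alpha> I J = \<beta> R\<close> into
  \<open>I J = d R\<close> with \<open>d = \<beta> / \<alpha>\<close>.\<close>

lemma invertible_cidealE:
  assumes "invertible_cideal R I"
  obtains J d where "nonzero_ideal R I" "nonzero_ideal R J" "d \<noteq> 0"
    "ideal_mult_set I J = (*) d ` R"
proof -
  obtain J \<alpha> \<beta> where J: "nonzero_ideal R I" "nonzero_ideal R J" "\<alpha> \<noteq> 0" "\<beta> \<noteq> 0"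
    "(*) \<alpha> ` ideal_mult_set I J = (*) \<beta> ` R"
    using assms unfolding invertible_cideal_def ideal_equiv_def by blast
  have "ideal_mult_set I J = (*) (1 / \<alpha>) ` (*) \<alpha> ` ideal_mult_set I J"
    using J(3) by (simp add: image_image)
  also have "\<dots> = (*) (\<beta> / \<alpha>) ` R"
    unfolding J(5) by (simp add: image_image)
  finally show ?thesis using that[of J "\<beta> / \<alpha>"] J by auto
qed

lemma invertible_cideal_ring: "invertible_cideal R R"
proof (rule invertible_cidealI)
  show "nonzero_ideal R R" "nonzero_ideal R R"
    unfolding nonzero_ideal_def using is_cideal_ring one_mem by fastforce+
  show "1 \<in> ideal_mult_set R R"
    using mult_mem_ideal_mult_set[of 1 R 1 R] by simp
qed auto

text \<open>From \<open>I I' = d R\<close> and \<open>J J' = e R\<close>, regrouping factors gives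
  \<open>(I J) (I' J') = d e R\<close>.\<close>

lemma invertible_cideal_mult:
  assumes "invertible_cideal R I" "invertible_cideal R J"
  shows "invertible_cideal R (ideal_mult_set I J)"
proof -
  obtain I' d where I': "nonzero_ideal R I" "nonzero_ideal R I'" "d \<noteq> 0"
    "ideal_mult_set I I' = (*) d ` R"
    using assms(1) by (rule invertible_cidealE)
  obtain J' e where J': "nonzero_ideal R J" "nonzero_ideal R J'" "e \<noteq> 0"
    "ideal_mult_set J J' = (*) e ` R"
    using assms(2) by (rule invertible_cidealE)
  let ?P = "ideal_mult_set (ideal_mult_set I J) (ideal_mult_set I' J')"
  have prod: "(x * x') * (y * y') \<in> ?P" if "x \<in> I" "x' \<in> I'" "y \<in> J" "y' \<in> J'" for x x' y y'
    using mult_mem_ideal_mult_set[OF mult_mem_ideal_mult_set[OF that(1,3)]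
        mult_mem_ideal_mult_set[OF that(2,4)]]
    by (simp add: algebra_simps)
  have de: "x * y \<in> ?P" if "x \<in> ideal_mult_set I I'" "y \<in> ideal_mult_set J J'" for x y
    using that(1)
  proof (induction rule: ideal_mult_set_induct)
    case (mult x x')
    note xx' = mult
    show ?case using that(2)
      by (induction rule: ideal_mult_set_induct)
        (use xx' prod in \<open>auto simp: zero_mem_ideal_mult_set add_mem_ideal_mult_set distrib_left\<close>)
  qed (auto simp: zero_mem_ideal_mult_set add_mem_ideal_mult_set distrib_right)
  show ?thesis
  proof (rule invertible_cidealI)
    show "nonzero_ideal R (ideal_mult_set I J)" "nonzero_ideal R (ideal_mult_set I' J')"
      using I' J' nonzero_ideal_mult by auto
    show "d * e \<noteq> 0" using I' J' by simp
    have "d \<in> ideal_mult_set I I'" "e \<in> ideal_mult_set J J'"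
      unfolding I'(4) J'(4) by (auto intro: image_eqI[of _ _ 1])
    then show "d * e \<in> ?P" by (rule de)
    fix x y assume x: "x \<in> ideal_mult_set I J" and y: "y \<in> ideal_mult_set I' J'"
    show "x * y \<in> (*) (d * e) ` R" using x
    proof (induction rule: ideal_mult_set_induct)
      case (mult a b)
      note ab = mult
      show ?case using y
      proof (induction rule: ideal_mult_set_induct)
        case (mult a' b')
        have "a * a' \<in> (*) d ` R" "b * b' \<in> (*) e ` R"
          using I'(4) J'(4) ab mult mult_mem_ideal_mult_set by blast+
        then obtain r s where "r \<in> R" "s \<in> R" "a * a' = d * r" "b * b' = e * s" by blast
        then have "a * b * (a' * b') = d * e * (r * s)" "r * s \<in> R"
          by (metis mult.assoc mult.left_commute) (use \<open>r \<in> R\<close> \<open>s \<in> R\<close> in blast)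
        then show ?case by blast
      qed (simp_all only: mult_zero_right distrib_left principal_zero principal_add)
    qed (simp_all only: mult_zero_left distrib_right principal_zero principal_add)
  qed
qed

section \<open>Reduction to maximal ideals\<close>

text \<open>Finiteness of the set of ideals above \<open>I\<close> takes the place of Zorn's
  lemma.\<close>

lemma exists_maximal_cideal:
  assumes "nonzero_ideal R I" "I \<noteq> R" "finite {J. is_cideal R J \<and> I \<subseteq> J}"
  obtains M where "maximal_cideal R M" "I \<subseteq> M"
proof -
  let ?A = "{J. is_cideal R J \<and> I \<subseteq> J \<and> J \<noteq> R}"
  have "finite ?A" by (rule finite_subset[OF _ assms(3)]) auto
  moreover have "I \<in> ?A" using assms unfolding nonzero_ideal_def by auto
  ultimately have "\<exists>M\<in>?A. \<forall>J\<in>?A. M \<subseteq> J \<longrightarrow> M = J"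
    by (intro finite_has_maximal) auto
  then obtain M where M: "M \<in> ?A" "\<forall>J\<in>?A. M \<subseteq> J \<longrightarrow> M = J"
    by (rule bexE)
  have "0 \<in> I" "I \<noteq> {0}"
    using assms(1) is_cidealD(2)[of R I] unfolding nonzero_ideal_def by auto
  then have "M \<noteq> {0}" using M(1) by blast
  moreover have "J = M \<or> J = R" if "is_cideal R J" "M \<subseteq> J" for J
    using M that by blast
  ultimately have "maximal_cideal R M"
    unfolding maximal_cideal_def nonzero_ideal_def using M(1) by blast
  then show ?thesis using that[of M] M(1) by blast
qed

theorem class_monoid_is_group_if_maximal_invertible:
  assumes fin: "\<And>I. nonzero_ideal R I \<Longrightarrow> finite {J. is_cideal R J \<and> I \<subseteq> J}"
    and inv: "\<And>M. maximal_cideal R M \<Longrightarrow> invertible_cideal R M"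
  shows "class_monoid_is_group R"
  unfolding class_monoid_is_group_def
proof (intro allI impI)
  fix I assume I: "nonzero_ideal R I"
  then have Ii: "is_cideal R I" unfolding nonzero_ideal_def by auto
  let ?A = "{J. invertible_cideal R J \<and> I \<subseteq> J}"
  have "?A \<subseteq> {J. is_cideal R J \<and> I \<subseteq> J}"
    unfolding invertible_cideal_def nonzero_ideal_def by auto
  then have "finite ?A" using fin[OF I] finite_subset by blast
  moreover have "R \<in> ?A" using invertible_cideal_ring is_cidealD(1)[OF Ii] by auto
  ultimately have "\<exists>J\<in>?A. \<forall>J'\<in>?A. J' \<subseteq> J \<longrightarrow> J = J'"
    by (intro finite_has_minimal) auto
  then obtain J where JA: "J \<in> ?A" "\<forall>J'\<in>?A. J' \<subseteq> J \<longrightarrow> J = J'"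
    by (rule bexE)
  then have J: "invertible_cideal R J" "I \<subseteq> J" by auto
  have min: "J' = J" if "invertible_cideal R J'" "I \<subseteq> J'" "J' \<subseteq> J" for J'
    using JA(2) that by blast
  obtain K d where K: "nonzero_ideal R J" "nonzero_ideal R K" "d \<noteq> 0"
    and JK: "ideal_mult_set J K = (*) d ` R"
    using J(1) by (rule invertible_cidealE)
  have Ki: "is_cideal R K" "is_cideal R J" using K unfolding nonzero_ideal_def by auto
  have dJK: "d \<in> ideal_mult_set J K" unfolding JK by (auto intro: image_eqI[of _ _ 1])
  have JK': "\<exists>r\<in>R. x * y = d * r" if "x \<in> J" "y \<in> K" for x y
    using mult_mem_ideal_mult_set[OF that] JK by auto
  \<comment> \<open>This is \<open>I J\<inverse>\<close>, as \<open>J\<inverse>\<close> is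
    \<open>K / d\<close>; it lies in \<open>R\<close> because \<open>I K\<close> is contained in
    \<open>J K = d R\<close>.\<close>
  define I' where "I' = {x \<in> R. d * x \<in> ideal_mult_set I K}"
  have IKi: "is_cideal R (ideal_mult_set I K)" using is_cideal_mult Ii Ki by auto
  have I'i: "is_cideal R I'"
    unfolding is_cideal_def I'_def using is_cidealD(2,3,4)[OF IKi]
    by (auto simp: distrib_left mult.left_commute[of d])
  have sub: "x \<in> ideal_mult_set I' J" if x: "x \<in> I" for x
  proof -
    \<comment> \<open>Regroup \<open>x (j k)\<close> as \<open>(x k) j\<close>, where
      \<open>x k / d\<close> lies in \<open>I'\<close>. The instance \<open>w = d\<close> followed
      by cancelling \<open>d\<close> puts \<open>x\<close> in \<open>I' J\<close>.\<close>
    have "\<exists>v \<in> ideal_mult_set I' J. x * w = d * v" if "w \<in> ideal_mult_set J K" for w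
      using that
    proof (induction rule: ideal_mult_set_induct)
      case zero
      then show ?case using zero_mem_ideal_mult_set by force
    next
      case (mult j k)
      obtain r where r: "r \<in> R" "x * k = d * r" using JK'[of x k] x J(2) mult by blast
      then have "r \<in> I'" unfolding I'_def
        using mult_mem_ideal_mult_set[OF x mult(2)] by auto
      then have "r * j \<in> ideal_mult_set I' J" using mult(1) by (rule mult_mem_ideal_mult_set)
      moreover have "x * (j * k) = d * (r * j)" using r by (simp add: algebra_simps)
      ultimately show ?case by blast
    next
      case (add u v)
      then show ?case by (metis add_mem_ideal_mult_set distrib_left)
    qed
    from this[OF dJK] obtain v where "v \<in> ideal_mult_set I' J" "x * d = d * v" by blast
    then show ?thesis using K(3) by simp
  qed
  show "invertible_cideal R I"
  proof (cases "I' = R")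
    case True
    then have "1 \<in> I'" by simp
    then have dIK: "d \<in> ideal_mult_set I K" unfolding I'_def by simp
    have "j \<in> I" if j: "j \<in> J" for j
    proof -
      \<comment> \<open>Here \<open>d\<close> itself lies in \<open>I K\<close>. Since
        \<open>j K\<close> is contained in \<open>d R\<close>, multiplication by \<open>j\<close>
        maps \<open>I K\<close> into \<open>d I\<close>; at \<open>w = d\<close> this gives that
        \<open>j\<close> is in \<open>I\<close>.\<close>
      have "\<exists>v\<in>I. j * w = d * v" if "w \<in> ideal_mult_set I K" for w
        using that
      proof (induction rule: ideal_mult_set_induct)
        case zero
        then show ?case using is_cidealD(2)[OF Ii] by force
      next
        case (mult i k)
        obtain r where "r \<in> R" "j * k = d * r" using JK'[OF j mult(2)] by blast
        then have "r * i \<in> I" "j * (i * k) = d * (r * i)"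
          using is_cidealD(4)[OF Ii _ mult(1)] by (simp_all add: mult.left_commute)
        then show ?case by blast
      next
        case (add u v)
        then show ?case by (metis is_cidealD(3)[OF Ii] distrib_left)
      qed
      from this[OF dIK] show ?thesis using K(3) by (auto simp: mult.commute)
    qed
    then have "I = J" using J(2) by auto
    then show ?thesis using J(1) by simp
  next
    case False
    obtain x where "x \<in> I" "x \<noteq> 0" using I Ii is_cidealD(2) unfolding nonzero_ideal_def by blast
    have "I' \<noteq> {0}"
    proof
      assume "I' = {0}"
      have "x = 0" using sub[OF \<open>x \<in> I\<close>]
        by (induction rule: ideal_mult_set_induct) (simp_all add: \<open>I' = {0}\<close>)
      then show False using \<open>x \<noteq> 0\<close> by simp
    qed
    then have I'n: "nonzero_ideal R I'" using I'i unfolding nonzero_ideal_def by auto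
    then obtain M where M: "maximal_cideal R M" "I' \<subseteq> M"
      using exists_maximal_cideal[OF _ False] fin by blast
    then have Mi: "is_cideal R M" "M \<noteq> R"
      unfolding maximal_cideal_def nonzero_ideal_def by auto
    have "I \<subseteq> ideal_mult_set M J"
      using sub M(2) unfolding ideal_mult_set_def by blast
    moreover have "ideal_mult_set M J \<subseteq> J"
    proof
      fix x assume "x \<in> ideal_mult_set M J"
      then show "x \<in> J"
      proof (induction rule: ideal_mult_set_induct)
        case (mult x y)
        then show ?case using is_cidealD(4)[OF Ki(2)] is_cidealD(1)[OF Mi(1)] by blast
      qed (simp_all only: is_cidealD(2,3)[OF Ki(2)])
    qed
    moreover have "invertible_cideal R (ideal_mult_set M J)"
      by (rule invertible_cideal_mult[OF inv[OF M(1)] J(1)])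
    \<comment> \<open>Minimality of \<open>J\<close> forces equality. Multiplying by
      \<open>K\<close> then shows that \<open>d\<close>, an element of \<open>J K = M J K\<close>,
      lies in \<open>d M\<close>, so \<open>1\<close> is in \<open>M\<close>, which is
      absurd.\<close>
    ultimately have MJ: "ideal_mult_set M J = J" using min by blast
    have *: "\<exists>m\<in>M. x * k = d * m" if x: "x \<in> ideal_mult_set M J" and k: "k \<in> K" for x k
      using x
    proof (induction rule: ideal_mult_set_induct)
      case zero
      then show ?case using is_cidealD(2)[OF Mi(1)] by force
    next
      case (mult m j)
      obtain r where "r \<in> R" "j * k = d * r" using JK'[OF mult(2) k] by blast
      then have "r * m \<in> M" "m * j * k = d * (r * m)"
        using is_cidealD(4)[OF Mi(1) _ mult(1)] by (simp_all only: mult.assoc, simp only: mult.left_commute mult.commute[of m])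
      then show ?case by blast
    next
      case (add u v)
      then show ?case by (metis is_cidealD(3)[OF Mi(1)] distrib_left distrib_right)
    qed
    have "\<exists>m\<in>M. w = d * m" if "w \<in> ideal_mult_set J K" for w
      using that
    proof (induction rule: ideal_mult_set_induct)
      case zero
      then show ?case using is_cidealD(2)[OF Mi(1)] by force
    next
      case (mult j k)
      then show ?case using * MJ by blast
    next
      case (add u v)
      then show ?case by (metis is_cidealD(3)[OF Mi(1)] distrib_left)
    qed
    from this[OF dJK] have "1 \<in> M" using K(3) by auto
    then show ?thesis using ideal_eq_ring Mi by blast
  qed
qed

section \<open>Multipliers of ideals and properties of maximal ideals\<close>

text \<open>If \<open>I J = d R\<close>, then \<open>u\<close> also maps \<open>d R\<close> into
  itself, so \<open>u d\<close> is in \<open>d R\<close> and \<open>d\<close> cancels. This is the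
  obstruction used to refute invertibility: a multiplier of \<open>I\<close> outside
  \<open>R\<close>.\<close>

lemma stabilizer_of_invertible_subset:
  assumes "invertible_cideal R I" "\<And>x. x \<in> I \<Longrightarrow> u * x \<in> I"
  shows "u \<in> R"
proof -
  obtain J d where d: "d \<noteq> 0" and IJ: "ideal_mult_set I J = (*) d ` R"
    using assms(1) by (rule invertible_cidealE)
  have "u * w \<in> ideal_mult_set I J" if "w \<in> ideal_mult_set I J" for w
    using that
  proof (induction rule: ideal_mult_set_induct)
    case (mult x y)
    then show ?case
      using mult_mem_ideal_mult_set[OF assms(2)[OF mult(1)] mult(2)] by (simp add: mult.assoc)
  qed (simp_all add: zero_mem_ideal_mult_set add_mem_ideal_mult_set distrib_left)
  moreover have "d \<in> ideal_mult_set I J" unfolding IJ by (auto intro: image_eqI[of _ _ 1])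
  ultimately have "u * d \<in> (*) d ` R" unfolding IJ by blast
  then show ?thesis using d by (auto simp: mult.commute[of u])
qed

text \<open>The ideal \<open>M + a R\<close> is strictly larger than \<open>M\<close>, hence all of
  \<open>R\<close>.\<close>

lemma maximal_cideal_comaximal:
  assumes "maximal_cideal R M" "a \<in> R" "a \<notin> M"
  obtains u r where "u \<in> M" "r \<in> R" "u + r * a = 1"
proof -
  have M: "is_cideal R M" using assms(1) unfolding maximal_cideal_def nonzero_ideal_def by simp
  let ?J = "{u + r * a | u r. u \<in> M \<and> r \<in> R}"
  have "is_cideal R ?J" unfolding is_cideal_def
  proof (intro conjI ballI)
    show "?J \<subseteq> R" using is_cidealD(1)[OF M] assms(2) by auto
    show "0 \<in> ?J" using is_cidealD(2)[OF M] by (auto intro!: exI[of _ 0])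
  next
    fix x y assume "x \<in> ?J" "y \<in> ?J"
    then obtain u r u' r' where *: "x = u + r * a" "y = u' + r' * a" "u \<in> M" "u' \<in> M" "r \<in> R" "r' \<in> R"
      by blast
    then have "x + y = (u + u') + (r + r') * a" by (simp add: algebra_simps)
    then show "x + y \<in> ?J" using * is_cidealD(3)[OF M *(3,4)] by blast
  next
    fix s x assume s: "s \<in> R" and "x \<in> ?J"
    then obtain u r where *: "x = u + r * a" "u \<in> M" "r \<in> R" by blast
    then have "s * x = s * u + (s * r) * a" by (simp add: algebra_simps)
    then show "s * x \<in> ?J" using * s is_cidealD(4)[OF M s *(2)] by blast
  qed
  moreover have "M \<subseteq> ?J" by (force intro: exI[of _ 0])
  moreover have "a \<in> ?J" using is_cidealD(2)[OF M] by (force intro: exI[of _ 0] exI[of _ 1])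
  ultimately have "?J = R" using assms unfolding maximal_cideal_def by blast
  then have "1 \<in> ?J" by simp
  then show ?thesis using that by force
qed

lemma maximal_cideal_prime:
  assumes "maximal_cideal R M" "a \<in> R" "b \<in> R" "a * b \<in> M"
  shows "a \<in> M \<or> b \<in> M"
proof (cases "a \<in> M")
  case False
  have M: "is_cideal R M" using assms(1) unfolding maximal_cideal_def nonzero_ideal_def by simp
  obtain u r where ur: "u \<in> M" "r \<in> R" "u + r * a = 1"
    using maximal_cideal_comaximal[OF assms(1,2) False] .
  have "b = b * (u + r * a)" using ur by simp
  also have "\<dots> = b * u + r * (a * b)" by (simp add: algebra_simps)
  finally show ?thesis
    using is_cidealD(3)[OF M is_cidealD(4)[OF M assms(3) ur(1)] is_cidealD(4)[OF M ur(2) assms(4)]]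
    by simp
qed simp

text \<open>With \<open>N = (d R : M)\<close> we have \<open>M N = d K\<close> for an ideal \<open>K \<supseteq> M\<close>, so \<open>M\<close> is invertible as soon
  as \<open>K \<noteq> M\<close>.\<close>

lemma maximal_cideal_invertibleI:
  assumes M: "maximal_cideal R M" and d: "d \<in> M" "d \<noteq> 0"
    and q: "q \<in> R" "\<And>x. x \<in> M \<Longrightarrow> q * x \<in> (*) d ` R"
    and y: "y \<in> M" "q * y \<notin> (*) d ` M"
  shows "invertible_cideal R M"
proof -
  have Mn: "nonzero_ideal R M" and Mi: "is_cideal R M"
    using M unfolding maximal_cideal_def nonzero_ideal_def by auto
  define N where "N = {x \<in> R. \<forall>z\<in>M. x * z \<in> (*) d ` R}"
  have Ni: "is_cideal R N" unfolding is_cideal_def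
  proof (intro conjI ballI)
    show "N \<subseteq> R" "0 \<in> N" unfolding N_def using principal_zero by auto
    show "x + x' \<in> N" if "x \<in> N" "x' \<in> N" for x x'
      using that unfolding N_def by (simp add: distrib_right principal_add add_mem)
    show "r * x \<in> N" if r: "r \<in> R" and "x \<in> N" for r x
      unfolding N_def
    proof (intro CollectI conjI ballI)
      have x: "x \<in> R" "\<forall>z\<in>M. x * z \<in> (*) d ` R" using \<open>x \<in> N\<close> unfolding N_def by auto
      show "r * x \<in> R" using r x(1) by (rule mult_mem)
      fix z assume "z \<in> M"
      then obtain s where s: "s \<in> R" "x * z = d * s" using x(2) by blast
      have "r * x * z = d * (r * s)" using s(2) by (simp add: mult.assoc mult.left_commute)
      moreover have "r * s \<in> R" using r s(1) by (rule mult_mem)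
      ultimately show "r * x * z \<in> (*) d ` R" by (rule image_eqI)
    qed
  qed
  have dN: "d \<in> N" unfolding N_def using d is_cidealD(1)[OF Mi] by auto
  have qN: "q \<in> N" unfolding N_def using q by blast
  have Nn: "nonzero_ideal R N" unfolding nonzero_ideal_def using Ni dN d(2) by auto
  \<comment> \<open>\<open>K\<close> is \<open>M N\<close> divided by \<open>d\<close>; it contains
    \<open>M\<close> because \<open>d\<close> is in \<open>N\<close>.\<close>
  define K where "K = {x \<in> R. d * x \<in> ideal_mult_set M N}"
  have MNi: "is_cideal R (ideal_mult_set M N)" by (rule is_cideal_mult[OF Mi Ni])
  have "is_cideal R K"
    unfolding is_cideal_def K_def using is_cidealD(2,3,4)[OF MNi]
    by (auto simp: distrib_left mult.left_commute[of d])
  moreover have "M \<subseteq> K"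
    unfolding K_def using is_cidealD(1)[OF Mi] mult_mem_ideal_mult_set[OF _ dN, of _ M]
    by (auto simp: mult.commute)
  moreover have "K \<noteq> M"
  proof
    assume KM: "K = M"
    \<comment> \<open>The quotient \<open>r = q y / d\<close> lies in \<open>K\<close>, but by the
      choice of \<open>y\<close> not in \<open>M\<close>.\<close>
    obtain r where r: "r \<in> R" "q * y = d * r" using q(2)[OF y(1)] by blast
    have "d * r \<in> ideal_mult_set M N"
      using mult_mem_ideal_mult_set[OF y(1) qN] r(2) by (simp add: mult.commute)
    then have "r \<in> M" using r(1) KM unfolding K_def by auto
    then show False using r(2) y(2) by auto
  qed
  ultimately have "K = R" using M unfolding maximal_cideal_def by blast
  then have "1 \<in> K" by simp
  then have "d \<in> ideal_mult_set M N" unfolding K_def by simp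
  moreover have "x * z \<in> (*) d ` R" if "x \<in> M" "z \<in> N" for x z
    using that unfolding N_def by (auto simp: mult.commute)
  ultimately show ?thesis by (rule invertible_cidealI[OF Mn Nn d(2)])
qed

end

section \<open>The cubic order\<close>

locale cubic_order =
  fixes n :: int and \<theta> :: complex
  assumes root: "poly (fpoly n) \<theta> = 0"
begin

section \<open>Coordinates in the cubic order\<close>

text \<open>Integer coordinates with respect to \<open>1, \<theta>, \<theta>^2\<close>. They exist
  by \<open>Zadj_eq\<close> and are unique by \<open>elt_eq_iff\<close>.\<close>

definition elt :: "int \<Rightarrow> int \<Rightarrow> int \<Rightarrow> complex" where
  "elt a b c = of_int a + of_int b * \<theta> + of_int c * \<theta> ^ 2"

lemma theta_cubed: "\<theta> ^ 3 = of_int n * \<theta> ^ 2 - (of_int n - 1) * \<theta> + 1"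
  using root by (simp add: fpoly_def algebra_simps power2_eq_square power3_eq_cube)

lemma elt_add: "elt a b c + elt a' b' c' = elt (a + a') (b + b') (c + c')"
  by (simp add: elt_def algebra_simps)

lemma elt_scale: "of_int k * elt a b c = elt (k * a) (k * b) (k * c)"
  by (simp add: elt_def algebra_simps)

lemma elt_theta: "\<theta> * elt a b c = elt c (a - (n - 1) * c) (b + n * c)"
proof -
  have "\<theta> * elt a b c = of_int a * \<theta> + of_int b * \<theta> ^ 2 + of_int c * \<theta> ^ 3"
    by (simp add: elt_def algebra_simps power2_eq_square power3_eq_cube)
  also have "\<dots> = elt c (a - (n - 1) * c) (b + n * c)"
    unfolding theta_cubed by (simp add: elt_def algebra_simps)
  finally show ?thesis .
qed

text \<open>Stated through repeated multiplication by \<open>\<theta>\<close>, so that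
  \<open>elt_theta\<close> evaluates any product without powers above the square.\<close>

lemma elt_mult:
  "elt x y z * elt a b c =
     of_int x * elt a b c + of_int y * (\<theta> * elt a b c) + of_int z * (\<theta> * (\<theta> * elt a b c))"
proof -
  have "elt x y z * e = of_int x * e + of_int y * (\<theta> * e) + of_int z * (\<theta> * (\<theta> * e))" for e
    by (simp add: elt_def algebra_simps power2_eq_square)
  then show ?thesis .
qed

text \<open>Horner's scheme: each further coefficient costs one multiplication by
  \<open>\<theta>\<close>, and the cubic relation keeps the result within three coordinates.\<close>

lemma Zadj_eq: "Zadj \<theta> = {elt a b c | a b c. True}"
proof -
  have "\<exists>a b c. poly (map_poly of_int p) \<theta> = elt a b c" for p :: "int poly"
  proof (induction p)
    case 0
    then show ?case by (auto simp: elt_def intro!: exI[of _ 0])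
  next
    case (pCons k p)
    then obtain a b c where "poly (map_poly of_int p) \<theta> = elt a b c" by blast
    then have "poly (map_poly of_int (pCons k p)) \<theta> = elt k 0 0 + \<theta> * elt a b c"
      using pCons(1) by (simp add: map_poly_pCons elt_def)
    then show ?case unfolding elt_theta elt_add by blast
  qed
  moreover have "\<exists>p :: int poly. elt a b c = poly (map_poly of_int p) \<theta>" for a b c
    by (rule exI[of _ "[:a, b, c:]"])
      (simp add: map_poly_pCons elt_def algebra_simps power2_eq_square)
  ultimately show ?thesis unfolding Zadj_def by blast
qed

lemma elt_mem [simp, intro]: "elt a b c \<in> Zadj \<theta>"
  unfolding Zadj_eq by blast

lemma ZadjE:
  assumes "x \<in> Zadj \<theta>"
  obtains a b c where "x = elt a b c"
  using assms unfolding Zadj_eq by blast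

sublocale complex_subring "Zadj \<theta>"
proof
  have "elt 1 0 0 = 1" by (simp add: elt_def)
  then show "1 \<in> Zadj \<theta>" by (metis elt_mem)
  show "- x \<in> Zadj \<theta>" if x: "x \<in> Zadj \<theta>" for x
  proof -
    obtain a b c where "x = elt a b c" using x by (rule ZadjE)
    then have "- x = elt (- a) (- b) (- c)" by (simp add: elt_def)
    then show ?thesis by simp
  qed
  show "x + y \<in> Zadj \<theta>" if "x \<in> Zadj \<theta>" "y \<in> Zadj \<theta>" for x y
    using that by (elim ZadjE) (simp add: elt_add)
  show "x * y \<in> Zadj \<theta>" if "x \<in> Zadj \<theta>" "y \<in> Zadj \<theta>" for x y
    using that by (elim ZadjE) (simp add: elt_mult elt_theta elt_scale elt_add)
qed

lemma theta_mem [simp, intro]: "\<theta> \<in> Zadj \<theta>"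
proof -
  have "\<theta> = elt 0 1 0" by (simp add: elt_def)
  then show ?thesis by (metis elt_mem)
qed

text \<open>The coefficients of \<open>y\<close> are the first row of the adjugate of the matrix of multiplication by
  \<open>elt a b c\<close>, and \<open>N\<close> is its determinant. It is odd because \<open>f\<close> is irreducible modulo \<open>2\<close>.\<close>

lemma elt_adjugate:
  obtains y N where "y \<in> Zadj \<theta>" "y * elt a b c = of_int N"
    "odd a \<or> odd b \<or> odd c \<longrightarrow> odd N"
proof -
  \<comment> \<open>Coordinates of \<open>\<theta> * elt a b c\<close>, and below them those of
    \<open>\<theta>^2 * elt a b c\<close>.\<close>
  define a1 b1 c1 where 1: "a1 = c" "b1 = a - (n - 1) * c" "c1 = b + n * c"
  define a2 b2 c2 where 2: "a2 = c1" "b2 = a1 - (n - 1) * c1" "c2 = b1 + n * c1"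
  \<comment> \<open>The cross product of \<open>(b, b1, b2)\<close> and \<open>(c, c1, c2)\<close>:
    orthogonality to both makes the coordinates of the product at \<open>\<theta>\<close> and
    \<open>\<theta>^2\<close> vanish.\<close>
  define x y z where xyz: "x = b1 * c2 - b2 * c1" "y = b2 * c - b * c2" "z = b * c1 - b1 * c"
  define N where "N = x * a + y * a1 + z * a2"
  have "elt x y z * elt a b c = elt (x * a + y * a1 + z * a2) (x * b + y * b1 + z * b2) (x * c + y * c1 + z * c2)"
    unfolding elt_mult elt_theta elt_scale elt_add 1 2 by simp
  also have "x * b + y * b1 + z * b2 = 0" unfolding xyz by (simp add: algebra_simps)
  also have "x * c + y * c1 + z * c2 = 0" unfolding xyz by (simp add: algebra_simps)
  finally have "elt x y z * elt a b c = of_int N" unfolding N_def by (simp add: elt_def)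
  \<comment> \<open>A finite check over the parities of \<open>a\<close>, \<open>b\<close>,
    \<open>c\<close> and \<open>n\<close>.\<close>
  moreover have "odd a \<or> odd b \<or> odd c \<longrightarrow> odd N"
    unfolding N_def xyz 2 1
    by (cases "even a"; cases "even b"; cases "even c"; cases "even n") simp_all
  ultimately show ?thesis by (rule that[OF elt_mem])
qed

section \<open>Nonzero integer multiples and linear independence\<close>

text \<open>Halve the coordinates until one of them is odd; the determinant is then odd and so
  nonzero. Only irreducibility of \<open>f\<close> modulo \<open>2\<close> enters, through this
  parity.\<close>

lemma elt_multiple_of_int:
  assumes "\<not> (a = 0 \<and> b = 0 \<and> c = 0)"
  shows "\<exists>y\<in>Zadj \<theta>. \<exists>N. N \<noteq> 0 \<and> y * elt a b c = of_int N"
  using assms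
proof (induction "nat (\<bar>a\<bar> + \<bar>b\<bar> + \<bar>c\<bar>)" arbitrary: a b c rule: less_induct)
  case less
  show ?case
  proof (cases "odd a \<or> odd b \<or> odd c")
    case True
    obtain y N where y: "y \<in> Zadj \<theta>" "y * elt a b c = of_int N"
      and "odd a \<or> odd b \<or> odd c \<longrightarrow> odd N"
      by (rule elt_adjugate[of a b c])
    then have "N \<noteq> 0" using True by auto
    then show ?thesis using y by blast
  next
    case False
    then obtain a' b' c' where abc: "a = 2 * a'" "b = 2 * b'" "c = 2 * c'" by (meson evenE)
    then have nz: "\<not> (a' = 0 \<and> b' = 0 \<and> c' = 0)" using less(2) by auto
    then have "0 < \<bar>a'\<bar> \<or> 0 < \<bar>b'\<bar> \<or> 0 < \<bar>c'\<bar>" by simp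
    moreover have "\<bar>a\<bar> = 2 * \<bar>a'\<bar>" "\<bar>b\<bar> = 2 * \<bar>b'\<bar>" "\<bar>c\<bar> = 2 * \<bar>c'\<bar>"
      unfolding abc by (simp_all add: abs_mult)
    ultimately have "nat (\<bar>a'\<bar> + \<bar>b'\<bar> + \<bar>c'\<bar>) < nat (\<bar>a\<bar> + \<bar>b\<bar> + \<bar>c\<bar>)"
      by auto
    then obtain y N where y: "y \<in> Zadj \<theta>" "N \<noteq> 0" "y * elt a' b' c' = of_int N"
      using less(1)[OF _ nz] by blast
    have "elt a b c = 2 * elt a' b' c'" using elt_scale[of 2 a' b' c'] abc by simp
    then have "y * elt a b c = of_int (2 * N)" using y(3) by simp
    moreover have "2 * N \<noteq> 0" using y(2) by simp
    ultimately show ?thesis using y(1) by blast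
  qed
qed

text \<open>A difference with a nonzero coordinate has a nonzero integer multiple, so it cannot be
  \<open>0\<close>.\<close>

lemma elt_eq_iff: "elt a b c = elt a' b' c' \<longleftrightarrow> a = a' \<and> b = b' \<and> c = c'"
proof
  assume "elt a b c = elt a' b' c'"
  then have "elt (a - a') (b - b') (c - c') = 0" by (simp add: elt_def algebra_simps)
  then show "a = a' \<and> b = b' \<and> c = c'"
    using elt_multiple_of_int[of "a - a'" "b - b'" "c - c'"] by auto
qed simp

lemma elt_principal_iff:
  "elt a b c \<in> (*) (of_int p) ` Zadj \<theta> \<longleftrightarrow> p dvd a \<and> p dvd b \<and> p dvd c"
proof
  assume "elt a b c \<in> (*) (of_int p) ` Zadj \<theta>"
  then obtain x y z where "elt a b c = of_int p * elt x y z" by (blast elim: ZadjE)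
  then show "p dvd a \<and> p dvd b \<and> p dvd c" unfolding elt_scale elt_eq_iff by simp
next
  assume "p dvd a \<and> p dvd b \<and> p dvd c"
  then obtain x y z where "a = p * x" "b = p * y" "c = p * z" by (auto elim!: dvdE)
  then show "elt a b c \<in> (*) (of_int p) ` Zadj \<theta>" by (auto simp flip: elt_scale)
qed

section \<open>Integers contained in ideals\<close>

lemma nonzero_ideal_contains_int:
  assumes "nonzero_ideal (Zadj \<theta>) I"
  obtains m :: int where "m > 0" "of_int m \<in> I"
proof -
  have I: "is_cideal (Zadj \<theta>) I" using assms unfolding nonzero_ideal_def by simp
  obtain x where x: "x \<in> I" "x \<noteq> 0"
    using assms is_cidealD(2)[OF I] unfolding nonzero_ideal_def by blast
  obtain a b c where abc: "x = elt a b c" using is_cidealD(1)[OF I] x(1) by (blast elim: ZadjE)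
  then have "\<not> (a = 0 \<and> b = 0 \<and> c = 0)" using x(2) by (auto simp: elt_def)
  then obtain y N where y: "y \<in> Zadj \<theta>" "N \<noteq> 0" "y * x = of_int N"
    using elt_multiple_of_int unfolding abc by blast
  have N: "of_int N \<in> I" using is_cidealD(4)[OF I y(1) x(1)] y(3) by simp
  have "of_int \<bar>N\<bar> \<in> I"
    using N is_cidealD(4)[OF I _ N, of "-1"] by (auto simp: abs_if)
  then show ?thesis using that[of "\<bar>N\<bar>"] y(2) by simp
qed

text \<open>With a positive integer \<open>m\<close> in \<open>I\<close>, an ideal above
  \<open>I\<close> is determined by its trace on the finite box \<open>B\<close> of representatives
  modulo \<open>m\<close>.\<close>

lemma finite_ideals_above:
  assumes "nonzero_ideal (Zadj \<theta>) I"
  shows "finite {J. is_cideal (Zadj \<theta>) J \<and> I \<subseteq> J}"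
proof -
  obtain m :: int where m: "m > 0" "of_int m \<in> I"
    using assms by (rule nonzero_ideal_contains_int)
  define B where "B = (\<lambda>(a, b, c). elt a b c) ` ({0..<m} \<times> {0..<m} \<times> {0..<m})"
  have "finite B" unfolding B_def by simp
  have sub: "J \<subseteq> J'" if J: "is_cideal (Zadj \<theta>) J" "I \<subseteq> J"
    and J': "is_cideal (Zadj \<theta>) J'" "I \<subseteq> J'" and eq: "J \<inter> B = J' \<inter> B" for J J'
  proof
    fix x assume x: "x \<in> J"
    obtain a b c where abc: "x = elt a b c" using is_cidealD(1)[OF J(1)] x by (blast elim: ZadjE)
    \<comment> \<open>The multiple of \<open>m\<close> that both ideals contain and whose
      subtraction moves \<open>x\<close> into the box.\<close>
    define w where "w = elt (a div m) (b div m) (c div m) * of_int m"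
    have w: "w \<in> J" "w \<in> J'"
      unfolding w_def using is_cidealD(4)[OF J(1) elt_mem] is_cidealD(4)[OF J'(1) elt_mem] m J J'
      by blast+
    have r: "x - w = elt (a mod m) (b mod m) (c mod m)"
      unfolding abc w_def mult.commute[of _ "of_int m"] elt_scale
      by (simp add: elt_def minus_mult_div_eq_mod [symmetric] algebra_simps)
    have "x - w \<in> B" unfolding r B_def using m by (auto intro!: image_eqI[of _ _ "(a mod m, b mod m, c mod m)"])
    then have "x - w \<in> J'" using ideal_diff[OF J(1) x w(1)] eq by blast
    then show "x \<in> J'" using is_cidealD(3)[OF J'(1) _ w(2), of "x - w"] by simp
  qed
  have "inj_on (\<lambda>J. J \<inter> B) {J. is_cideal (Zadj \<theta>) J \<and> I \<subseteq> J}"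
    by (rule inj_onI) (metis (lifting) mem_Collect_eq sub subset_antisym)
  moreover have "(\<lambda>J. J \<inter> B) ` {J. is_cideal (Zadj \<theta>) J \<and> I \<subseteq> J} \<subseteq> Pow B" by blast
  ultimately show ?thesis using \<open>finite B\<close> inj_on_finite by blast
qed

text \<open>The integers in \<open>M\<close> form a nonzero proper prime ideal; \<open>p\<close> is
  its least positive element, and division with remainder shows that it generates.\<close>

lemma maximal_cideal_contains_prime:
  assumes M: "maximal_cideal (Zadj \<theta>) M"
  obtains p :: int where "prime p" "\<And>k. of_int k \<in> M \<longleftrightarrow> p dvd k"
proof -
  have Mn: "nonzero_ideal (Zadj \<theta>) M" and Mi: "is_cideal (Zadj \<theta>) M" and MR: "M \<noteq> Zadj \<theta>"
    using M unfolding maximal_cideal_def nonzero_ideal_def by auto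
  obtain m :: int where m: "m > 0" "of_int m \<in> M"
    using Mn by (rule nonzero_ideal_contains_int)
  let ?P = "\<lambda>k::nat. k > 0 \<and> of_int (int k) \<in> M"
  have ex: "?P (nat m)" using m by simp
  define p where "p = int (LEAST k. ?P k)"
  have p: "p > 0" "of_int p \<in> M" using LeastI[of ?P, OF ex] unfolding p_def by auto
  have least: "p \<le> k" if "k > 0" "of_int k \<in> M" for k
    using Least_le[of ?P "nat k"] that unfolding p_def by auto
  have dvd: "of_int k \<in> M \<longleftrightarrow> p dvd k" for k
  proof
    assume k: "of_int k \<in> M"
    have "of_int (k mod p) = of_int k - of_int (k div p) * (of_int p :: complex)"
      by (simp add: minus_div_mult_eq_mod [symmetric])
    then have "of_int (k mod p) \<in> M"
      using ideal_diff[OF Mi k is_cidealD(4)[OF Mi of_int_mem p(2)], of "k div p"] by simp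
    then have "k mod p = 0"
      using least[of "k mod p"] p(1) pos_mod_bound[of p k] pos_mod_sign[of p k] by linarith
    then show "p dvd k" by auto
  next
    assume "p dvd k"
    then obtain j where "k = j * p" by (metis dvdE mult.commute)
    then show "of_int k \<in> M" using is_cidealD(4)[OF Mi of_int_mem p(2), of j] by simp
  qed
  have "1 \<notin> M" using ideal_eq_ring[OF Mi] MR by blast
  then have "\<not> p dvd 1" using dvd[of 1] by simp
  moreover have "p dvd a \<or> p dvd b" if "p dvd a * b" for a b
  proof -
    have "of_int a * of_int b \<in> M" using that dvd[of "a * b"] by simp
    then have "of_int a \<in> M \<or> of_int b \<in> M"
      by (rule maximal_cideal_prime[OF M of_int_mem of_int_mem])
    then show ?thesis unfolding dvd .
  qed
  ultimately have "prime p"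
    using p(1) unfolding prime_def prime_elem_def by simp
  then show ?thesis using dvd by (rule that)
qed

text \<open>The coefficients of the minimal polynomial \<open>f(x + c)\<close> of \<open>\<theta> - c\<close>.\<close>

definition A where "A c = 3 * c - n"
definition B where "B c = 3 * c ^ 2 - 2 * c * n + n - 1"
definition F where "F c = c ^ 3 - n * c ^ 2 + (n - 1) * c - 1"

section \<open>Expansion of the cubic at an integer\<close>

text \<open>Taylor expansion of \<open>f\<close> at \<open>c\<close>, evaluated at the root. It
  exhibits the cofactor of \<open>t\<close> that serves as \<open>q\<close> for the linear maximal
  ideals.\<close>

lemma shifted_cubic:
  assumes "t = \<theta> - of_int c"
  shows "t * (t ^ 2 + of_int (A c) * t + of_int (B c)) = - of_int (F c)"
proof -
  have \<theta>: "\<theta> = t + of_int c" using assms by simp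
  have "t * (t ^ 2 + of_int (A c) * t + of_int (B c)) + of_int (F c)
      = \<theta> ^ 3 - (of_int n * \<theta> ^ 2 - (of_int n - 1) * \<theta> + 1)"
    unfolding \<theta> A_def B_def F_def by (simp add: algebra_simps power2_eq_square power3_eq_cube)
  then show ?thesis using theta_cubed by (simp add: eq_neg_iff_add_eq_0)
qed

text \<open>\<open>B c\<close> is \<open>f'(c)\<close> and \<open>F c\<close> is
  \<open>f(c)\<close>; each congruence is, up to sign, the divisibility of one of them.\<close>

lemma singular_iff:
  "[(2 * c - 1) * n = 3 * c ^ 2 - 1] (mod p) \<and> [(c ^ 2 - c) * n = c ^ 3 - c - 1] (mod p ^ 2)
     \<longleftrightarrow> p dvd B c \<and> p ^ 2 dvd F c"
proof -
  have "(2 * c - 1) * n - (3 * c ^ 2 - 1) = - B c" "(c ^ 2 - c) * n - (c ^ 3 - c - 1) = - F c"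
    unfolding B_def F_def by (simp_all add: algebra_simps)
  then show ?thesis unfolding cong_iff_dvd_diff by simp
qed

section \<open>Invertibility of the ideals above a prime\<close>

lemma singular_not_invertible:
  assumes p: "prime p" and B: "p dvd B c" and F: "p ^ 2 dvd F c"
  shows "\<not> invertible_cideal (Zadj \<theta>) (ideal2 (Zadj \<theta>) (\<theta> - of_int c) (of_int p))"
proof
  define t where "t = \<theta> - of_int c"
  assume inv: "invertible_cideal (Zadj \<theta>) (ideal2 (Zadj \<theta>) (\<theta> - of_int c) (of_int p))"
  obtain b f where b: "B c = p * b" and f: "F c = p ^ 2 * f" using B F unfolding dvd_def by blast
  have p0: "(of_int p :: complex) \<noteq> 0" using prime_gt_0_int[OF p] by simp
  define u where "u = t * (t + of_int (A c)) / of_int p"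
  have tR: "t \<in> Zadj \<theta>" unfolding t_def by (intro diff_mem theta_mem of_int_mem)
  \<comment> \<open>Both divisibilities enter here: dividing by \<open>p\<close> leaves integer
    multiples of \<open>t\<close> and of \<open>p\<close>, so \<open>u t\<close> stays in the
    ideal.\<close>
  have "of_int p * (u * t) = t * (t ^ 2 + of_int (A c) * t + of_int (B c)) - of_int (B c) * t"
    unfolding u_def using p0 by (simp add: field_simps power2_eq_square)
  also have "\<dots> = of_int p * (- of_int b * t - of_int f * of_int p)"
    unfolding shifted_cubic[OF t_def] unfolding b f by (simp add: algebra_simps power2_eq_square)
  finally have ut: "u * t = - of_int b * t - of_int f * of_int p" using p0 by simp
  have up: "u * of_int p = (t + of_int (A c)) * t" unfolding u_def using p0 by simp
  have "u * x \<in> ideal2 (Zadj \<theta>) (\<theta> - of_int c) (of_int p)"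
    if x: "x \<in> ideal2 (Zadj \<theta>) (\<theta> - of_int c) (of_int p)" for x
  proof -
    obtain r s where rs: "r \<in> Zadj \<theta>" "s \<in> Zadj \<theta>" "x = r * t + s * of_int p"
      using x unfolding t_def by (rule ideal2E)
    have "u * x = r * (u * t) + s * (u * of_int p)" unfolding rs(3) by (simp add: algebra_simps)
    also have "\<dots> = (r * (- of_int b) + s * (t + of_int (A c))) * t + (r * (- of_int f)) * of_int p"
      unfolding ut up by (simp add: algebra_simps)
    finally have eq: "u * x = (r * (- of_int b) + s * (t + of_int (A c))) * t + (r * (- of_int f)) * of_int p" .
    have "r * (- of_int b) + s * (t + of_int (A c)) \<in> Zadj \<theta>" "r * (- of_int f) \<in> Zadj \<theta>"
      by (intro add_mem mult_mem uminus_mem of_int_mem rs tR)+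
    then show ?thesis using eq unfolding t_def by (rule ideal2I)
  qed
  then have "u \<in> Zadj \<theta>" by (rule stabilizer_of_invertible_subset[OF inv])
  then have "of_int p * u \<in> (*) (of_int p) ` Zadj \<theta>" by (rule imageI)
  \<comment> \<open>The coordinate \<open>1\<close> at \<open>\<theta>^2\<close> is not divisible by
    \<open>p\<close>, hence \<open>u\<close> is outside the ring.\<close>
  moreover have "of_int p * u = elt (c ^ 2 - A c * c) (A c - 2 * c) 1"
    unfolding mult.commute[of _ u] up t_def by (simp add: elt_def algebra_simps power2_eq_square)
  ultimately have "p dvd 1" by (simp add: elt_principal_iff)
  then show False using p by (simp add: not_prime_unit)
qed

text \<open>Apply \<open>maximal_cideal_invertibleI\<close> with \<open>d = p\<close>, the cofactor
  \<open>q\<close> of \<open>t\<close>, and \<open>y\<close> one of the two generators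
  \<open>p\<close> and \<open>t\<close> of \<open>M\<close>. If neither \<open>y\<close> worked,
  \<open>p\<close> would divide both \<open>B c\<close> and \<open>F c / p\<close>.\<close>

lemma maximal_linear_invertible:
  assumes M: "maximal_cideal (Zadj \<theta>) M" and p: "prime p" and pM: "\<And>k. of_int k \<in> M \<longleftrightarrow> p dvd k"
    and t: "t = \<theta> - of_int c" "t \<in> M"
    and nonsing: "\<not> (p dvd B c \<and> p ^ 2 dvd F c)"
  shows "invertible_cideal (Zadj \<theta>) M"
proof -
  have Mi: "is_cideal (Zadj \<theta>) M" using M unfolding maximal_cideal_def nonzero_ideal_def by simp
  define q where "q = t ^ 2 + of_int (A c) * t + of_int (B c)"
  have tR: "t \<in> Zadj \<theta>" unfolding t(1) by (intro diff_mem theta_mem of_int_mem)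
  have qR: "q \<in> Zadj \<theta>" unfolding q_def power2_eq_square by (intro add_mem mult_mem of_int_mem tR)
  have tq: "q * t = - of_int (F c)" using shifted_cubic[OF t(1)] unfolding q_def by (simp add: mult.commute)
  have "of_int (- F c) \<in> M" using is_cidealD(4)[OF Mi qR t(2)] tq by simp
  then have "p dvd F c" unfolding pM by simp
  then obtain f where f: "F c = p * f" by (auto elim: dvdE)
  have p0: "(of_int p :: complex) \<noteq> 0" "of_int p \<in> M" using p pM by auto
  have qM: "q * x \<in> (*) (of_int p) ` Zadj \<theta>" if x: "x \<in> M" for x
  proof -
    obtain a b d where abd: "x = elt a b d" using is_cidealD(1)[OF Mi] x by (blast elim: ZadjE)
    \<comment> \<open>Quotient of \<open>a + b x + d x^2\<close> by \<open>x - c\<close>; the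
      remainder is its value \<open>k\<close> at \<open>c\<close>.\<close>
    define s where "s = elt (b + d * c) d 0"
    define k where "k = a + b * c + d * c ^ 2"
    have xs: "x = of_int k + s * t"
      unfolding abd s_def k_def t(1) by (simp add: elt_def algebra_simps power2_eq_square)
    have sR: "s \<in> Zadj \<theta>" unfolding s_def by simp
    have "of_int k \<in> M" using ideal_diff[OF Mi x is_cidealD(4)[OF Mi sR t(2)]] xs by simp
    then obtain j where j: "k = p * j" using pM by (auto elim: dvdE)
    have "q * x = of_int k * q + s * (q * t)" unfolding xs by (simp add: algebra_simps)
    also have "\<dots> = of_int p * (of_int j * q + s * (- of_int f))"
      unfolding tq j f by (simp add: algebra_simps)
    finally have "q * x = of_int p * (of_int j * q + s * (- of_int f))" .
    moreover have "of_int j * q + s * (- of_int f) \<in> Zadj \<theta>"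
      by (intro add_mem mult_mem uminus_mem of_int_mem qR sR)
    ultimately show ?thesis by (rule image_eqI)
  qed
  consider "q * of_int p \<notin> (*) (of_int p) ` M" | "q * t \<notin> (*) (of_int p) ` M"
  proof -
    have False if "q * of_int p \<in> (*) (of_int p) ` M" "q * t \<in> (*) (of_int p) ` M"
    proof -
      have "q \<in> M" using that(1) p0 by (auto simp: mult.commute)
      \<comment> \<open>Modulo \<open>t\<close> the cofactor \<open>q\<close> is the constant
        \<open>B c\<close>, so \<open>q\<close> in \<open>M\<close> would give
        \<open>p dvd B c\<close>.\<close>
      moreover have "of_int (B c) = q - (t + of_int (A c)) * t"
        unfolding q_def by (simp add: algebra_simps power2_eq_square)
      moreover have "(t + of_int (A c)) * t \<in> M" by (intro is_cidealD(4)[OF Mi _ t(2)] add_mem of_int_mem tR)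
      ultimately have "of_int (B c) \<in> M" using ideal_diff[OF Mi] by metis
      then have "p dvd B c" using pM by simp
      moreover have "of_int (- f) \<in> M" using that(2) p0 unfolding tq f by (auto simp: minus_equation_iff[of _ "of_int p * _"] simp flip: mult_minus_right)
      then have "p dvd f" using pM by (metis dvd_minus_iff)
      ultimately show False using nonsing f by (simp add: power2_eq_square)
    qed
    then show ?thesis using that by blast
  qed
  then show ?thesis
    using maximal_cideal_invertibleI[OF M p0(2,1) qR qM] p0(2) t(2) by cases blast+
qed

text \<open>With no \<open>\<theta> - c\<close> in \<open>M\<close>, the image of
  \<open>\<theta>\<close> has degree \<open>3\<close> or \<open>2\<close> over the field with
  \<open>p\<close> elements. In the first case \<open>M = p R\<close>; in the second
  \<open>M\<close> contains a monic quadratic \<open>g\<close>, whose cofactor is linear and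
  therefore outside \<open>M\<close>.\<close>

lemma maximal_nonlinear_invertible:
  assumes M: "maximal_cideal (Zadj \<theta>) M" and p: "prime p" and pM: "\<And>k. of_int k \<in> M \<longleftrightarrow> p dvd k"
    and nonlin: "\<And>c. \<theta> - of_int c \<notin> M"
  shows "invertible_cideal (Zadj \<theta>) M"
proof -
  have Mi: "is_cideal (Zadj \<theta>) M" using M unfolding maximal_cideal_def nonzero_ideal_def by simp
  have p0: "(of_int p :: complex) \<noteq> 0" "of_int p \<in> M" using p pM by auto
  have pR: "(*) (of_int p) ` Zadj \<theta> \<subseteq> M"
    using is_cidealD(4)[OF Mi _ p0(2)] by (auto simp: mult.commute)
  have inverse: "\<exists>b' k. b' * b = 1 + p * k" if "\<not> p dvd b" for b
  proof -
    have "coprime b p" using that p by (metis coprime_commute prime_imp_coprime)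
    then obtain b' where "[b * b' = 1] (mod p)" using cong_solve_coprime_int by blast
    then show ?thesis by (metis cong_iff_lin cong_sym mult.commute)
  qed
  \<comment> \<open>If \<open>p\<close> did not divide \<open>b\<close>, scaling by an inverse of
    \<open>b\<close> modulo \<open>p\<close> would produce some \<open>\<theta> - c\<close> in
    \<open>M\<close>.\<close>
  have lin: "p dvd a \<and> p dvd b" if ab: "elt a b 0 \<in> M" for a b
  proof -
    have "p dvd b"
    proof (rule ccontr)
      assume "\<not> p dvd b"
      then obtain b' k where bk: "b' * b = 1 + p * k" using inverse by blast
      have "elt (b' * a) (b' * b) 0 \<in> M"
        using is_cidealD(4)[OF Mi of_int_mem ab, of b'] by (simp add: elt_scale)
      moreover have "elt 0 (p * k) 0 \<in> M" using pR elt_principal_iff[of 0 "p * k" 0 p] by auto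
      ultimately have "elt (b' * a) (b' * b) 0 - elt 0 (p * k) 0 \<in> M" by (rule ideal_diff[OF Mi])
      then show False using nonlin[of "- (b' * a)"] by (simp add: elt_def bk algebra_simps)
    qed
    moreover from this have "elt 0 b 0 \<in> M" using pR elt_principal_iff[of 0 b 0 p] by auto
    then have "elt a b 0 - elt 0 b 0 \<in> M" by (rule ideal_diff[OF Mi ab])
    then have "of_int a \<in> M" by (simp add: elt_def)
    ultimately show ?thesis using pM by simp
  qed
  have one: "1 \<notin> M" using pM[of 1] p by (auto simp: not_prime_unit)
  show ?thesis
  proof (cases "M \<subseteq> (*) (of_int p) ` Zadj \<theta>")
    case True
    then have "1 * x \<in> (*) (of_int p) ` Zadj \<theta>" if "x \<in> M" for x using that by auto
    \<comment> \<open>Here \<open>M = p R\<close>, and the criterion applies with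
      \<open>q = 1\<close> and \<open>y = p\<close>.\<close>
    moreover have "1 * of_int p \<notin> (*) (of_int p) ` M" using one p0 by auto
    ultimately show ?thesis using maximal_cideal_invertibleI[OF M p0(2,1) one_mem _ p0(2)] by blast
  next
    case False
    then obtain x where x: "x \<in> M" "x \<notin> (*) (of_int p) ` Zadj \<theta>" by blast
    obtain a b d where abd: "x = elt a b d" using is_cidealD(1)[OF Mi] x by (blast elim: ZadjE)
    have "\<not> p dvd d"
    proof
      assume d: "p dvd d"
      then have "elt 0 0 d \<in> M" using pR elt_principal_iff[of 0 0 d p] by auto
      then have "x - elt 0 0 d \<in> M" by (rule ideal_diff[OF Mi x(1)])
      then have "elt a b 0 \<in> M" unfolding abd by (simp add: elt_def)
      then show False using lin x(2) abd d elt_principal_iff by auto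
    qed
    then obtain d' k where dk: "d' * d = 1 + p * k" using inverse by blast
    define \<alpha> \<beta> where "\<alpha> = d' * a" and "\<beta> = d' * b"
    define g where "g = elt \<alpha> \<beta> 1"
    have "elt (d' * a) (d' * b) (d' * d) \<in> M"
      using is_cidealD(4)[OF Mi of_int_mem x(1), of d'] by (simp add: elt_scale abd)
    moreover have "elt 0 0 (p * k) \<in> M" using pR elt_principal_iff[of 0 0 "p * k" p] by auto
    ultimately have "elt (d' * a) (d' * b) (d' * d) - elt 0 0 (p * k) \<in> M" by (rule ideal_diff[OF Mi])
    then have g: "g \<in> M" by (simp add: g_def \<alpha>_def \<beta>_def elt_def dk algebra_simps)
    \<comment> \<open>\<open>x - e\<close> is the quotient of \<open>f\<close> by
      \<open>x^2 + \<beta> x + \<alpha>\<close>: comparing coefficients of \<open>x^2\<close> gives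
      \<open>\<beta> - e = - n\<close>. Thus \<open>q g\<close> has degree at most one in
      \<open>\<theta>\<close>, and \<open>lin\<close> makes it divisible by
      \<open>p\<close>.\<close>
    define e where "e = \<beta> + n"
    define q where "q = \<theta> - of_int e"
    have qR: "q \<in> Zadj \<theta>" unfolding q_def by (intro diff_mem theta_mem of_int_mem)
    have "q * g = \<theta> * g - of_int e * g" unfolding q_def by (simp add: algebra_simps)
    also have "\<dots> = elt (1 - e * \<alpha>) (\<alpha> - (n - 1) - e * \<beta>) 0"
      unfolding g_def elt_theta elt_scale by (simp add: elt_def e_def algebra_simps)
    finally have qg: "q * g = \<dots>" .
    then have "q * g \<in> (*) (of_int p) ` Zadj \<theta>"
      using lin is_cidealD(4)[OF Mi qR g] elt_principal_iff by simp
    then obtain h where h: "h \<in> Zadj \<theta>" "q * g = of_int p * h" by blast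
    have qM: "q * y \<in> (*) (of_int p) ` Zadj \<theta>" if y: "y \<in> M" for y
    proof -
      obtain u v w where uvw: "y = elt u v w" using is_cidealD(1)[OF Mi] y by (blast elim: ZadjE)
      \<comment> \<open>Reduction of \<open>y\<close> by the monic \<open>g\<close> leaves a linear
        element of \<open>M\<close>, which lies in \<open>p R\<close> by \<open>lin\<close>.\<close>
      have *: "y - of_int w * g = elt (u - w * \<alpha>) (v - w * \<beta>) 0"
        unfolding uvw g_def by (simp add: elt_def algebra_simps)
      have "y - of_int w * g \<in> M" by (rule ideal_diff[OF Mi y is_cidealD(4)[OF Mi of_int_mem g]])
      then have "y - of_int w * g \<in> (*) (of_int p) ` Zadj \<theta>"
        unfolding * using lin elt_principal_iff by simp
      then obtain r where r: "r \<in> Zadj \<theta>" "y - of_int w * g = of_int p * r" by blast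
      have "q * y = q * (y - of_int w * g) + of_int w * (q * g)" by (simp add: algebra_simps)
      also have "\<dots> = of_int p * (q * r + of_int w * h)"
        unfolding r h by (simp add: algebra_simps)
      finally have "q * y = of_int p * (q * r + of_int w * h)" .
      moreover have "q * r + of_int w * h \<in> Zadj \<theta>"
        by (intro add_mem mult_mem of_int_mem qR r(1) h(1))
      ultimately show ?thesis by (rule image_eqI)
    qed
    have "q * of_int p \<notin> (*) (of_int p) ` M"
      using nonlin[of e] p0 unfolding q_def by (auto simp: mult.commute)
    then show ?thesis using maximal_cideal_invertibleI[OF M p0(2,1) qR qM p0(2)] by blast
  qed
qed

section \<open>The criterion for the class monoid\<close>

lemma class_monoid_is_group_iff:
  "class_monoid_is_group (Zadj \<theta>) \<longleftrightarrow> \<not> (\<exists>c p. prime p \<and> p dvd B c \<and> p ^ 2 dvd F c)"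
proof
  assume nonsing: "\<not> (\<exists>c p. prime p \<and> p dvd B c \<and> p ^ 2 dvd F c)"
  show "class_monoid_is_group (Zadj \<theta>)"
  proof (rule class_monoid_is_group_if_maximal_invertible[OF finite_ideals_above])
    fix M assume M: "maximal_cideal (Zadj \<theta>) M"
    obtain p :: int where p: "prime p" "\<And>k. of_int k \<in> M \<longleftrightarrow> p dvd k"
      using maximal_cideal_contains_prime[OF M] by blast
    show "invertible_cideal (Zadj \<theta>) M"
    \<comment> \<open>The first case is that of a residue field with exactly \<open>p\<close>
      elements; only there can the congruences obstruct.\<close>
    proof (cases "\<exists>c. \<theta> - of_int c \<in> M")
      case True
      then obtain c where "\<theta> - of_int c \<in> M" by blast
      then show ?thesis using maximal_linear_invertible[OF M p refl] nonsing p(1) by blast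
    next
      case False
      then show ?thesis using maximal_nonlinear_invertible[OF M p] by blast
    qed
  qed
next
  assume grp: "class_monoid_is_group (Zadj \<theta>)"
  show "\<not> (\<exists>c p. prime p \<and> p dvd B c \<and> p ^ 2 dvd F c)"
  proof
    assume "\<exists>c p. prime p \<and> p dvd B c \<and> p ^ 2 dvd F c"
    then obtain c p where cp: "prime p" "p dvd B c" "p ^ 2 dvd F c" by blast
    let ?I = "ideal2 (Zadj \<theta>) (\<theta> - of_int c) (of_int p)"
    have "is_cideal (Zadj \<theta>) ?I"
      by (intro is_cideal_ideal2 diff_mem theta_mem of_int_mem)
    moreover have "of_int p \<in> ?I" by (rule ideal2I[OF zero_mem one_mem]) simp
    moreover have "(of_int p :: complex) \<noteq> 0" using cp(1) by auto
    ultimately have "nonzero_ideal (Zadj \<theta>) ?I" unfolding nonzero_ideal_def by blast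
    then show False
      using grp singular_not_invertible[OF cp] unfolding class_monoid_is_group_def by blast
  qed
qed

end

theorem theorem3:
  fixes n :: int and \<theta> :: complex
  assumes root: "poly (fpoly n) \<theta> = 0"
  shows "(\<not> class_monoid_is_group (Zadj \<theta>) \<longleftrightarrow>
           (\<exists>c p :: int. prime p \<and> [(2 * c - 1) * n = 3 * c ^ 2 - 1] (mod p)
                        \<and> [(c ^ 2 - c) * n = c ^ 3 - c - 1] (mod p ^ 2)))
       \<and> (\<forall>c p :: int. prime p \<and> [(2 * c - 1) * n = 3 * c ^ 2 - 1] (mod p)
                        \<and> [(c ^ 2 - c) * n = c ^ 3 - c - 1] (mod p ^ 2)
            \<longrightarrow> \<not> invertible_cideal (Zadj \<theta>) (ideal2 (Zadj \<theta>) (\<theta> - of_int c) (of_int p)))"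
proof -
  interpret cubic_order n \<theta> using root by unfold_locales
  show ?thesis
    unfolding singular_iff using class_monoid_is_group_iff singular_not_invertible by blast
qed

end
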